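(* For all integers $q\geq 2$, $s\geq 3$ and $k\geq 1$, $$K_{q}^{\mathcal{R}}(2k,s,ks)\leq q^{ks}-q^{k(s-2)}(q^{k}-1).$$
   Context: NRT poset: for positive integers $m,s$, the NRT poset $[m\cdot s]$ is the set $\{1,\ldots,ms\}$ partitioned into $m$ blocks $B_i=\{is+1,\ldots,(i+1)s\}$, $i=0,\ldots,m-1$, where each block is a chain $is+1\preceq is+2\preceq\cdots\preceq (i+1)s$ and elements of different blocks are incomparable. An ideal is a subset $I$ such that $b\in I$ and $a\preceq b$ imply $a\in I$; $\langle A\rangle$ denotes the smallest ideal containing $A$. NRT distance: for $x,y\in\mathbb{Z}_q^{ms}$, $d_{\mathcal{R}}(x,y)=|\langle\{i: x_i\neq y_i\}\rangle|$, the ideal being taken in $[m\cdot s]$. Covering codes: a subset $C\subseteq \mathbb{Z}_q^{ms}$ is an $R$-covering of the NRT space $\mathbb{Z}_q^{ms}$ if for every $x\in\mathbb{Z}_q^{ms}$ there is $c\in C$ with $d_{\mathcal{R}}(x,c)\leq R$. $K_q^{\mathcal{R}}(m,s,R)$ is the smallest cardinality of an $R$-covering of the NRT space $\mathbb{Z}_q^{ms}$ (with respect to the NRT poset $[m\cdot s]$). *)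

theory Defs
  imports Main "HOL-Library.FuncSet"
begin

definition nrt_carrier :: "nat \<Rightarrow> nat \<Rightarrow> nat set" where
  "nrt_carrier m s = {1..m * s}"

definition nrt_block :: "nat \<Rightarrow> nat \<Rightarrow> nat set" where
  "nrt_block s i = {i * s + 1..(i + 1) * s}"

definition nrt_le :: "nat \<Rightarrow> nat \<Rightarrow> nat \<Rightarrow> nat \<Rightarrow> bool" where
  "nrt_le m s a b \<longleftrightarrow> (\<exists>i<m. a \<in> nrt_block s i \<and> b \<in> nrt_block s i \<and> a \<le> b)"

definition nrt_ideal :: "nat \<Rightarrow> nat \<Rightarrow> nat set \<Rightarrow> bool" where
  "nrt_ideal m s I \<longleftrightarrow>
     I \<subseteq> nrt_carrier m s \<and> (\<forall>b\<in>I. \<forall>a\<in>nrt_carrier m s. nrt_le m s a b \<longrightarrow> a \<in> I)"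

(* Intended for A \<subseteq> nrt_carrier m s; the carrier itself is then an ideal containing A. *)
definition nrt_ideal_generated :: "nat \<Rightarrow> nat \<Rightarrow> nat set \<Rightarrow> nat set" where
  "nrt_ideal_generated m s A = \<Inter> {I. nrt_ideal m s I \<and> A \<subseteq> I}"

(* Z_q is represented by the residues {0..<q}; only equality of coordinates is ever used.
   Words are extensional functions on the index set {1..m * s}. *)
definition nrt_space :: "nat \<Rightarrow> nat \<Rightarrow> nat \<Rightarrow> (nat \<Rightarrow> nat) set" where
  "nrt_space q m s = nrt_carrier m s \<rightarrow>\<^sub>E {0..<q}"

definition nrt_dist :: "nat \<Rightarrow> nat \<Rightarrow> (nat \<Rightarrow> nat) \<Rightarrow> (nat \<Rightarrow> nat) \<Rightarrow> nat" where
  "nrt_dist m s x y = card (nrt_ideal_generated m s {i \<in> nrt_carrier m s. x i \<noteq> y i})"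

definition nrt_covering :: "nat \<Rightarrow> nat \<Rightarrow> nat \<Rightarrow> nat \<Rightarrow> (nat \<Rightarrow> nat) set \<Rightarrow> bool" where
  "nrt_covering q m s R C \<longleftrightarrow>
     C \<subseteq> nrt_space q m s \<and> (\<forall>x\<in>nrt_space q m s. \<exists>c\<in>C. nrt_dist m s x c \<le> R)"

definition nrt_covering_number :: "nat \<Rightarrow> nat \<Rightarrow> nat \<Rightarrow> nat \<Rightarrow> nat" where
  "nrt_covering_number q m s R = (LEAST n. \<exists>C. nrt_covering q m s R C \<and> card C = n)"

lemma finite_nrt_space: "finite (nrt_space q m s)"
  unfolding nrt_space_def nrt_carrier_def by (intro finite_PiE) auto

lemma nrt_dist_self: "nrt_dist m s x x = 0"
proof -
  have "nrt_ideal m s {}" by (simp add: nrt_ideal_def)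
  then have "nrt_ideal_generated m s {} = {}"
    unfolding nrt_ideal_generated_def by blast
  then show ?thesis by (simp add: nrt_dist_def)
qed

(* The LEAST in nrt_covering_number ranges over a nonempty set, and every covering is finite,
   so card is the true cardinality. *)
lemma nrt_covering_space: "nrt_covering q m s R (nrt_space q m s)"
  unfolding nrt_covering_def using nrt_dist_self by (metis order_refl le0)

lemma nrt_covering_finite: "nrt_covering q m s R C \<Longrightarrow> finite C"
  unfolding nrt_covering_def using finite_nrt_space finite_subset by blast

end

theory Submission
  imports Defs
begin

text \<open>Split a word into its left and right \<open>k\<close> blocks. The words \<open>(w, w)\<close> whose half \<open>w\<close> is not
  identically zero on the maximal elements of its blocks cover every word having such a half, with
  the other half (of size \<open>k * s\<close>) as error ideal. A remaining word vanishes on all maximal elements.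
  It is covered by the word obtained by zeroing the right half and the minimal elements of the left
  half: the errors lie in an ideal of size \<open>k + k * (s - 1)\<close>, and only \<open>q ^ (k * (s - 2))\<close> such
  codewords exist.\<close>

section \<open>Maximal and minimal elements of the blocks\<close>

definition top_layer :: "nat \<Rightarrow> nat \<Rightarrow> nat set" where
  "top_layer m s = {p \<in> {1..m * s}. s dvd p}"

text \<open>Residues modulo \<open>s\<close> describe both layers without naming a block, so
  membership survives a shift by whole blocks. For \<open>s = 1\<close> the residue \<open>1\<close>
  never occurs and this set is empty; it consists of the block minima once \<open>s\<close> is at
  least 2.\<close>

definition bottom_layer :: "nat \<Rightarrow> nat \<Rightarrow> nat set" where
  "bottom_layer m s = {p \<in> {1..m * s}. p mod s = 1}"

lemma top_layer_eq:
  assumes "s > 0"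
  shows "top_layer m s = (\<lambda>i. (i + 1) * s) ` {..<m}"
proof (intro set_eqI iffI)
  fix p assume "p \<in> top_layer m s"
  then obtain j where j: "p = s * j" "1 \<le> p" "p \<le> m * s"
    by (auto simp: top_layer_def)
  from j have "j > 0" by (cases j) auto
  moreover have "j \<le> m" using j assms by (simp add: mult.commute)
  ultimately have "p = (j - 1 + 1) * s" "j - 1 < m"
    using j(1) by (auto simp: mult.commute)
  then show "p \<in> (\<lambda>i. (i + 1) * s) ` {..<m}" by blast
next
  fix p assume "p \<in> (\<lambda>i. (i + 1) * s) ` {..<m}"
  then obtain i where i: "p = (i + 1) * s" "i < m" by blast
  have "(i + 1) * s \<le> m * s" by (rule mult_right_mono) (use i in auto)
  then show "p \<in> top_layer m s"
    using i assms by (simp add: top_layer_def)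
qed

lemma bottom_layer_eq:
  assumes "s \<ge> 2"
  shows "bottom_layer m s = (\<lambda>i. i * s + 1) ` {..<m}"
proof (intro set_eqI iffI)
  fix p assume "p \<in> bottom_layer m s"
  then have p: "p \<le> m * s" "p mod s = 1" by (auto simp: bottom_layer_def)
  have eq: "p = (p div s) * s + 1" using p(2) div_mult_mod_eq[of p s] by simp
  with p(1) have "(p div s) * s < m * s" by linarith
  then have "p div s < m" by simp
  with eq show "p \<in> (\<lambda>i. i * s + 1) ` {..<m}" by blast
next
  fix p assume "p \<in> (\<lambda>i. i * s + 1) ` {..<m}"
  then obtain i where i: "p = i * s + 1" "i < m" by blast
  have "(i + 1) * s \<le> m * s" by (rule mult_right_mono) (use i in auto)
  then show "p \<in> bottom_layer m s"
    using i assms mod_mult_self1[of 1 i s] by (simp add: bottom_layer_def)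
qed

lemma card_top_layer: "s > 0 \<Longrightarrow> card (top_layer m s) = m"
  by (simp add: top_layer_eq card_image inj_on_def)

lemma card_bottom_layer: "s \<ge> 2 \<Longrightarrow> card (bottom_layer m s) = m"
  by (simp add: bottom_layer_eq card_image inj_on_def)

lemma top_bottom_disjoint: "s \<ge> 2 \<Longrightarrow> top_layer m s \<inter> bottom_layer m s = {}"
  by (auto simp: top_layer_def bottom_layer_def)

lemma layers_subset:
  "top_layer m s \<subseteq> nrt_carrier m s" "bottom_layer m s \<subseteq> nrt_carrier m s"
  by (auto simp: top_layer_def bottom_layer_def nrt_carrier_def)

section \<open>Ideals of the poset and bounds on the distance\<close>

lemma nrt_block_dvdD:
  assumes "p \<in> nrt_block s i" "s dvd p"
  shows "p = (i + 1) * s"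
proof -
  obtain j where j: "p = j * s" using assms(2) by (metis dvd_def mult.commute)
  have "i * s < j * s" "j * s \<le> (i + 1) * s"
    using assms(1) unfolding nrt_block_def j atLeastAtMost_iff by linarith+
  then have "j = i + 1" unfolding mult_less_cancel2 mult_le_cancel2 by simp
  with j show ?thesis by simp
qed

lemma nrt_block_mod_1D:
  assumes "p \<in> nrt_block s i" "p mod s = 1" "s \<ge> 2"
  shows "p = i * s + 1"
proof -
  have eq: "p = (p div s) * s + 1" using assms(2) div_mult_mod_eq[of p s] by simp
  have "i * s \<le> (p div s) * s" "(p div s) * s < (i + 1) * s"
    using assms(1) eq unfolding nrt_block_def atLeastAtMost_iff by linarith+
  then have "p div s = i" unfolding mult_less_cancel2 mult_le_cancel2 using assms(3) by simp
  with eq show ?thesis by simp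
qed

text \<open>The generated ideal is an intersection, hence contained in every ideal that contains the
  error positions. Distances are therefore only bounded, by exhibiting a suitable ideal.\<close>

lemma nrt_dist_le_card_ideal:
  assumes "nrt_ideal m s I" "\<And>i. i \<in> nrt_carrier m s \<Longrightarrow> x i \<noteq> y i \<Longrightarrow> i \<in> I"
  shows "nrt_dist m s x y \<le> card I"
  unfolding nrt_dist_def
proof (rule card_mono)
  show "finite I"
    using assms(1) finite_subset unfolding nrt_ideal_def nrt_carrier_def by blast
  show "nrt_ideal_generated m s {i \<in> nrt_carrier m s. x i \<noteq> y i} \<subseteq> I"
    using assms unfolding nrt_ideal_generated_def by blast
qed

lemma nrt_ideal_left: "n \<le> m \<Longrightarrow> nrt_ideal m s {1..n * s}"
  unfolding nrt_ideal_def nrt_carrier_def nrt_le_def nrt_block_def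
  by (auto intro: order_trans[OF _ mult_right_mono])

text \<open>Comparable elements share a block, and \<open>n * s\<close> is the end of a block, so it
  never separates them.\<close>

lemma nrt_le_gt:
  assumes "nrt_le m s a b" "n * s < b"
  shows "n * s < a"
proof -
  obtain i where i: "a \<in> nrt_block s i" "b \<in> nrt_block s i"
    using assms(1) by (auto simp: nrt_le_def)
  then have "n * s < (i + 1) * s" using assms(2) by (simp add: nrt_block_def)
  then have "n \<le> i" unfolding mult_less_cancel2 by simp
  then have "n * s \<le> i * s" by simp
  with i show ?thesis unfolding nrt_block_def atLeastAtMost_iff by linarith
qed

lemma nrt_ideal_right: "nrt_ideal m s {n * s + 1..m * s}"
  using nrt_le_gt[of m s _ _ n] unfolding nrt_ideal_def nrt_carrier_def
  by (fastforce simp: Suc_le_eq)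

text \<open>A block contains a single multiple of \<open>s\<close>, its last element, and a single
  element of residue 1, its first. Nothing in the block lies above the former or below the
  latter.\<close>

lemma nrt_le_same_block:
  assumes "nrt_le m s a b" "s \<ge> 2"
  shows "s dvd a \<Longrightarrow> s dvd b" and "b mod s = 1 \<Longrightarrow> a mod s = 1"
proof -
  obtain i where i: "a \<in> nrt_block s i" "b \<in> nrt_block s i" "a \<le> b"
    using assms(1) by (auto simp: nrt_le_def)
  show "s dvd b" if "s dvd a"
  proof -
    have "a = (i + 1) * s" using i that nrt_block_dvdD by blast
    with i have "b = (i + 1) * s" unfolding nrt_block_def atLeastAtMost_iff by linarith
    then show ?thesis by simp
  qed
  show "a mod s = 1" if "b mod s = 1"
  proof -
    have "b = i * s + 1" using i that assms(2) nrt_block_mod_1D by blast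
    with i have "a = b" unfolding nrt_block_def atLeastAtMost_iff by linarith
    with that show ?thesis by simp
  qed
qed

text \<open>Minimal elements are down-closed by themselves, and a union of blocks stays down-closed
  when its maximal elements are dropped. The two pieces lie in different blocks and do not
  interact.\<close>

lemma nrt_ideal_bottom_left_nontop_right:
  assumes "s \<ge> 2" "n \<le> m"
  shows "nrt_ideal m s (bottom_layer n s \<union> ({n * s + 1..m * s} - top_layer m s))"
    (is "nrt_ideal m s ?J")
proof -
  have "?J \<subseteq> nrt_carrier m s"
    using mult_right_mono[OF assms(2), of s, OF le0]
    unfolding bottom_layer_def nrt_carrier_def subset_iff Un_iff Diff_iff mem_Collect_eq
      atLeastAtMost_iff
    by (metis add_leD2 order_trans)
  moreover have "a \<in> ?J"
    if b: "b \<in> ?J" and a: "a \<in> nrt_carrier m s" and le: "nrt_le m s a b" for a b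
  proof (cases "b \<le> n * s")
    case True
    with b have "b mod s = 1" by (auto simp: bottom_layer_def)
    then have "a mod s = 1" using nrt_le_same_block le assms(1) by blast
    moreover have "a \<le> b" using le by (auto simp: nrt_le_def)
    ultimately show ?thesis using True a by (simp add: bottom_layer_def nrt_carrier_def)
  next
    case False
    with b have "\<not> s dvd b" by (auto simp: bottom_layer_def top_layer_def)
    then have "\<not> s dvd a" using nrt_le_same_block le assms(1) by blast
    moreover have "n * s < a" using nrt_le_gt[OF le] False by simp
    ultimately show ?thesis using a by (simp add: top_layer_def nrt_carrier_def)
  qed
  ultimately show ?thesis unfolding nrt_ideal_def by blast
qed

lemma card_bottom_left_nontop_right:
  assumes "s \<ge> 2" "n \<le> m"
  shows "card (bottom_layer n s \<union> ({n * s + 1..m * s} - top_layer m s))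
    \<le> n + (m - n) * (s - 1)"
proof -
  \<comment> \<open>Only the maximal elements beyond \<open>n * s\<close> meet the interval;
    removing exactly these makes the subtraction of cardinalities valid.\<close>
  let ?U = "top_layer m s - top_layer n s"
  have "{n * s + 1..m * s} - top_layer m s = {n * s + 1..m * s} - ?U"
    by (auto simp: top_layer_def)
  moreover have "?U \<subseteq> {n * s + 1..m * s}" by (auto simp: top_layer_def)
  moreover have "card ?U = m - n"
  proof -
    have "top_layer n s \<subseteq> top_layer m s"
      using mult_right_mono[OF assms(2), of s] by (auto simp: top_layer_def)
    moreover have "finite (top_layer n s)" by (simp add: top_layer_def)
    ultimately show ?thesis
      using assms(1) by (simp add: card_Diff_subset card_top_layer)
  qed
  moreover have "finite ?U" by (simp add: top_layer_def)
  ultimately have "card ({n * s + 1..m * s} - top_layer m s) = m * s - n * s - (m - n)"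
    by (simp add: card_Diff_subset)
  also have "\<dots> = (m - n) * (s - 1)"
    by (simp add: diff_mult_distrib diff_mult_distrib2)
  finally show ?thesis
    using card_Un_le[of "bottom_layer n s" "{n * s + 1..m * s} - top_layer m s"]
      card_bottom_layer[OF assms(1), of n] by linarith
qed

section \<open>Counting words with prescribed zeros\<close>

definition vanishing :: "nat \<Rightarrow> nat \<Rightarrow> nat \<Rightarrow> nat set \<Rightarrow> (nat \<Rightarrow> nat) set" where
  "vanishing q m s Z = {w \<in> nrt_space q m s. \<forall>p\<in>Z. w p = 0}"

text \<open>The set is a product of coordinate sets, singletons on \<open>Z\<close> and of size
  \<open>q\<close> elsewhere. Positivity of \<open>q\<close> makes 0 a legal letter.\<close>

lemma card_vanishing:
  assumes "q > 0" "Z \<subseteq> nrt_carrier m s"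
  shows "card (vanishing q m s Z) = q ^ (m * s - card Z)"
proof -
  let ?N = "nrt_carrier m s"
  have fin: "finite ?N" by (simp add: nrt_carrier_def)
  have "vanishing q m s Z = (\<Pi>\<^sub>E p\<in>?N. if p \<in> Z then {0} else {0..<q})"
  proof (rule set_eqI)
    fix w
    have "(\<forall>p\<in>?N. w p \<in> {0..<q}) \<and> (\<forall>p\<in>Z. w p = 0) \<longleftrightarrow>
        (\<forall>p\<in>?N. w p \<in> (if p \<in> Z then {0} else {0..<q}))"
      using assms by (auto split: if_splits)
    then show "w \<in> vanishing q m s Z \<longleftrightarrow> w \<in> (\<Pi>\<^sub>E p\<in>?N. if p \<in> Z then {0} else {0..<q})"
      unfolding vanishing_def nrt_space_def PiE_iff mem_Collect_eq by blast
  qed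
  then have "card (vanishing q m s Z) = (\<Prod>p\<in>?N. if p \<in> Z then 1 else q)"
    using fin by (simp add: card_PiE if_distrib cong: if_cong)
  also have "\<dots> = q ^ card (?N - Z)"
    using fin by (simp add: prod.If_cases Diff_eq Collect_neg_eq)
  also have "card (?N - Z) = m * s - card Z"
    using assms(2) fin finite_subset
    by (subst card_Diff_subset) (auto simp: nrt_carrier_def)
  finally show ?thesis .
qed

section \<open>The code, its covering property and its size\<close>

definition double_word :: "nat \<Rightarrow> (nat \<Rightarrow> nat) \<Rightarrow> nat \<Rightarrow> nat" where
  "double_word n w = (\<lambda>p\<in>{1..2 * n}. if p \<le> n then w p else w (p - n))"

definition pad_word :: "nat \<Rightarrow> (nat \<Rightarrow> nat) \<Rightarrow> nat \<Rightarrow> nat" where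
  "pad_word n w = (\<lambda>p\<in>{1..2 * n}. if p \<le> n then w p else 0)"

text \<open>Compared with all \<open>q ^ (k * s)\<close> doubled words, those whose half vanishes on
  the top layer are traded for a smaller family of padded words; this exchange is the whole
  saving.\<close>

definition nrt_code :: "nat \<Rightarrow> nat \<Rightarrow> nat \<Rightarrow> (nat \<Rightarrow> nat) set" where
  "nrt_code q k s =
     double_word (k * s) ` (nrt_space q k s - vanishing q k s (top_layer k s)) \<union>
     pad_word (k * s) ` vanishing q k s (top_layer k s \<union> bottom_layer k s)"

lemma nrt_code_subset:
  assumes "q > 0"
  shows "nrt_code q k s \<subseteq> nrt_space q (2 * k) s"
proof -
  have "double_word (k * s) w \<in> nrt_space q (2 * k) s"
    "pad_word (k * s) w \<in> nrt_space q (2 * k) s" if "w \<in> nrt_space q k s" for w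
  proof -
    have "w p < q" if "1 \<le> p" "p \<le> k * s" for p
      using \<open>w \<in> nrt_space q k s\<close> that by (auto simp: nrt_space_def nrt_carrier_def PiE_iff)
    then show "double_word (k * s) w \<in> nrt_space q (2 * k) s"
      "pad_word (k * s) w \<in> nrt_space q (2 * k) s"
      using assms
      by (auto simp: nrt_space_def nrt_carrier_def double_word_def pad_word_def mult.assoc)
  qed
  then show ?thesis by (auto simp: nrt_code_def vanishing_def)
qed

lemma nrt_code_covers:
  assumes "q > 0" "s \<ge> 2" "x \<in> nrt_space q (2 * k) s"
  shows "\<exists>c\<in>nrt_code q k s. nrt_dist (2 * k) s x c \<le> k * s"
proof -
  define n where "n = k * s"
  have two: "2 * k * s = 2 * n" by (simp add: n_def)
  define l where "l = (\<lambda>p\<in>{1..n}. x p)"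
  define r where "r = (\<lambda>p\<in>{1..n}. x (p + n))"
  have x: "x p < q" if "1 \<le> p" "p \<le> 2 * n" for p
    using assms(3) that two by (auto simp: nrt_space_def nrt_carrier_def PiE_iff)
  have l: "l \<in> nrt_space q k s" and r: "r \<in> nrt_space q k s"
    using x by (auto simp: l_def r_def nrt_space_def nrt_carrier_def n_def)
  consider (left) "l \<notin> vanishing q k s (top_layer k s)"
    | (right) "r \<notin> vanishing q k s (top_layer k s)"
    | (none) "l \<in> vanishing q k s (top_layer k s)" "r \<in> vanishing q k s (top_layer k s)"
    by blast
  then show ?thesis
  proof cases
    case left
    \<comment> \<open>The left halves agree, so all errors lie in the last \<open>k\<close>
      blocks.\<close>
    have "nrt_dist (2 * k) s x (double_word n l) \<le> card {n + 1..2 * n}"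
      using nrt_ideal_right[of "2 * k" s k] unfolding two n_def[symmetric]
      by (rule nrt_dist_le_card_ideal)
        (auto simp: nrt_carrier_def two double_word_def l_def split: if_splits)
    with left l show ?thesis by (auto simp: nrt_code_def n_def)
  next
    case right
    have "nrt_dist (2 * k) s x (double_word n r) \<le> card {1..n}"
      using nrt_ideal_left[of k "2 * k" s] unfolding n_def[symmetric]
      by (rule nrt_dist_le_card_ideal)
        (auto simp: nrt_carrier_def two double_word_def r_def split: if_splits)
    with right r show ?thesis by (auto simp: nrt_code_def n_def)
  next
    case none
    \<comment> \<open>This is \<open>l\<close> with its block minima set to 0. Since
      \<open>l\<close> already vanishes on the top layer, \<open>w\<close> vanishes on both
      layers.\<close>
    define w where "w = (\<lambda>p\<in>{1..n}. if p \<in> bottom_layer k s then 0 else x p)"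
    have w: "w \<in> vanishing q k s (top_layer k s \<union> bottom_layer k s)"
      using none(1) x assms(1)
      by (auto simp: vanishing_def nrt_space_def nrt_carrier_def w_def l_def n_def
          top_layer_def bottom_layer_def split: if_splits)
    \<comment> \<open>As \<open>n\<close> is a multiple of \<open>s\<close>, shifting by
      \<open>n\<close> carries the top layer of the right half to that of \<open>r\<close>, where
      \<open>r\<close> vanishes. Hence padding with 0 makes no error there.\<close>
    have right_top: "x p = 0" if "p \<in> top_layer (2 * k) s" "n < p" for p
    proof -
      have "p - n \<in> top_layer k s"
        using that by (auto simp: top_layer_def two n_def)
      then have "r (p - n) = 0" using none(2) by (simp add: vanishing_def)
      moreover have "p - n \<in> {1..n}" using that by (auto simp: top_layer_def two)
      ultimately show ?thesis using that by (simp add: r_def)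
    qed
    have "nrt_dist (2 * k) s x (pad_word n w)
        \<le> card (bottom_layer k s \<union> ({k * s + 1..2 * k * s} - top_layer (2 * k) s))"
    proof (rule nrt_dist_le_card_ideal)
      show "nrt_ideal (2 * k) s
          (bottom_layer k s \<union> ({k * s + 1..2 * k * s} - top_layer (2 * k) s))"
        using assms(2) by (intro nrt_ideal_bottom_left_nontop_right) auto
    next
      fix p assume "p \<in> nrt_carrier (2 * k) s" "x p \<noteq> pad_word n w p"
      then show "p \<in> bottom_layer k s \<union> ({k * s + 1..2 * k * s} - top_layer (2 * k) s)"
        using right_top
        by (auto simp: nrt_carrier_def two pad_word_def w_def n_def[symmetric] split: if_splits)
    qed
    also have "\<dots> \<le> k + (2 * k - k) * (s - 1)"
      using assms(2) by (intro card_bottom_left_nontop_right) auto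
    also have "\<dots> = k * s" using assms(2) by (cases s) (auto simp: algebra_simps)
    finally show ?thesis using w by (auto simp: nrt_code_def n_def)
  qed
qed

text \<open>An upper bound is enough, so images and the union are estimated without proving
  injectivity or disjointness.\<close>

lemma card_nrt_code_le:
  assumes "q > 0" "s \<ge> 2"
  shows "card (nrt_code q k s) \<le> (q ^ (k * s) - q ^ (k * (s - 1))) + q ^ (k * (s - 2))"
proof -
  let ?T = "vanishing q k s (top_layer k s)"
  let ?B = "vanishing q k s (top_layer k s \<union> bottom_layer k s)"
  have fin: "finite (vanishing q k s Z)" for Z
    using finite_nrt_space by (simp add: vanishing_def)
  have space: "card (nrt_space q k s) = q ^ (k * s)"
    by (simp add: nrt_space_def nrt_carrier_def card_PiE)
  have T: "card ?T = q ^ (k * (s - 1))"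
    using assms by (simp add: card_vanishing layers_subset card_top_layer diff_mult_distrib2)
  \<comment> \<open>The layers are disjoint, so \<open>2 * k\<close> coordinates are fixed and
    \<open>k * (s - 2)\<close> stay free.\<close>
  have "card (top_layer k s \<union> bottom_layer k s) = k * 2"
    using assms top_bottom_disjoint
    by (subst card_Un_disjoint)
      (auto simp: card_top_layer card_bottom_layer, auto simp: top_layer_def bottom_layer_def)
  then have B: "card ?B = q ^ (k * (s - 2))"
    using assms by (simp add: card_vanishing layers_subset diff_mult_distrib2)
  have "card (nrt_code q k s) \<le> card (nrt_space q k s - ?T) + card ?B"
    unfolding nrt_code_def
    using finite_nrt_space fin
    by (intro order_trans[OF card_Un_le] add_mono card_image_le) auto
  also have "card (nrt_space q k s - ?T) = q ^ (k * s) - q ^ (k * (s - 1))"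
    using fin space T by (subst card_Diff_subset) (auto simp: vanishing_def)
  finally show ?thesis unfolding B .
qed

theorem theorem13:
  fixes q s k :: nat
  assumes "q \<ge> 2" and "s \<ge> 3" and "k \<ge> 1"
  shows "int (nrt_covering_number q (2 * k) s (k * s))
           \<le> int q ^ (k * s) - int q ^ (k * (s - 2)) * (int q ^ k - 1)"
proof -
  have "nrt_covering q (2 * k) s (k * s) (nrt_code q k s)"
    unfolding nrt_covering_def using assms nrt_code_subset nrt_code_covers by simp
  then have "nrt_covering_number q (2 * k) s (k * s) \<le> card (nrt_code q k s)"
    unfolding nrt_covering_number_def by (intro Least_le) blast
  also have "\<dots> \<le> (q ^ (k * s) - q ^ (k * (s - 1))) + q ^ (k * (s - 2))"
    using assms by (intro card_nrt_code_le) auto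
  finally have "int (nrt_covering_number q (2 * k) s (k * s))
      \<le> int (q ^ (k * s) - q ^ (k * (s - 1))) + int (q ^ (k * (s - 2)))"
    by linarith
  \<comment> \<open>This keeps the natural-number subtraction from truncating, so it agrees with the
    integer one.\<close>
  moreover have "q ^ (k * (s - 1)) \<le> q ^ (k * s)"
    using assms by (intro power_increasing) auto
  \<comment> \<open>Splits \<open>q ^ (k * (s - 1))\<close> as
    \<open>q ^ (k * (s - 2)) * q ^ k\<close>, which produces the factor
    \<open>q ^ k - 1\<close>.\<close>
  moreover have "k * (s - 1) = k * (s - 2) + k"
  proof -
    have "s - 1 = (s - 2) + 1" using assms(2) by simp
    then show ?thesis by (simp only: add_mult_distrib2 mult_1_right)
  qed
  ultimately show ?thesis
    by (simp add: of_nat_diff power_add right_diff_distrib)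
qed

end
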